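(* Let $G=(N,E)$ be a finite directed graph and $T\ge1$ an integer. For $k\in\{1,2\}$ let $m_k\in\mathbb N$, let $A_{k,-},A_{k,+}:\mathbb R^N\to\mathbb R^{m_k}$ be linear, let $b_k\in\mathbb R^{m_k}$, and assume that $$S=\{(\mu,\nu)\in\mathbb R^N\times\mathbb R^N: A_{1,-}[\mu]+A_{1,+}[\nu]=b_1,\ A_{2,-}[\mu]+A_{2,+}[\nu]\ge b_2\}\subseteq\mathcal P(N)\times\mathcal P(N).$$ Let $H\in C^1(\mathbb R^{E^T}_{\ge0})$. For any $i\in\operatorname{BP}(G^{T,\Omega},\mathcal M^\Omega(S),H)$ there exist $u\in\mathbb R^{N^{T,\Omega}}$, $u_1\in\mathbb R^{m_1}$, $u_2\in\mathbb R^{m_2}$ such that $$\iota_0^T[u]=A_{1,-}^T[u_1]-A_{2,-}^T[u_2],\qquad \iota_\Omega^T[u]=-\big(A_{1,+}^T[u_1]-A_{2,+}^T[u_2]\big),$$ and $$\begin{cases}\min\{i,\nabla H(i)-Du\}=0\ \text{ in }E^{T,\Omega},\\ \operatorname{div}i=0\ \text{ in }N\times\{1,\dots,T\},\\ \min\{A_{2,-}[\iota_0^T[\operatorname{div}i]]-A_{2,+}[\iota_\Omega^T[\operatorname{div}i]]-b_2,\ u_2\}=0,\\ A_{1,-}[\iota_0^T[\operatorname{div}i]]-A_{1,+}[\iota_\Omega^T[\operatorname{div}i]]=b_1.\end{cases}$$ Moreover, if $H$ is convex, then the previous equations (for some $i\in\mathbb R^{E^{T,\Omega}}$ and such $u,u_1,u_2$)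 imply that $i\in\operatorname{BP}(G^{T,\Omega},\mathcal M^\Omega(S),H)$.
   Context: A directed graph is $G=(N,E)$ with $N$ finite and $E\subseteq N\times N$; for an edge $e=(x,y)$, $e^-=x$, $e^+=y$. $\mathcal P(N)$ is the set of probability distributions on $N$; $\mathbb R^X$ is the set of functions $X\to\mathbb R$. On any directed graph, $\operatorname{div}i(x)=\sum_{e^-=x}i(e)-\sum_{e^+=x}i(e)$ and $Du(e)=u(e^+)-u(e^-)$. Vector inequalities and minima are coordinatewise; $A^T$ denotes the transpose of a linear map $A$. Extended graphs: $N^T=N\times\{0,\dots,T\}$, and $E^T$ consists of the edges $((x,t-1),(y,t))$ for $(x,y)\in E$, $t\in\{1,\dots,T\}$. With a symbol $\Omega$, $N^\Omega=N\times\{\Omega\}$, $E^\Omega=\{((x,t),(x,\Omega)): x\in N,\ t\in\{1,\dots,T\}\}$, $N^{T,\Omega}=N^T\cup N^\Omega$, $E^{T,\Omega}=E^T\cup E^\Omega$, $G^{T,\Omega}=(N^{T,\Omega},E^{T,\Omega})$. $\iota_0,\iota_\Omega:\mathbb R^N\to\mathbb R^{N^{T,\Omega}}$: $\iota_0[\mu]$ equals $\mu(x)$ at $(x,0)$ and zero elsewhere; $\iota_\Omega[\nu]$ equals $\nu(x)$ at $(x,\Omega)$ and zero elsewhere. Their transposes are $\iota_0^T[f](x)=f(x,0)$, $\iota_\Omega^T[f](x)=f(x,\Omega)$. $\mathcal M^\Omega(S)=\{f\in\mathbb R^{N^{T,\Omega}}: f=\iota_0[\mu]-\iota_\Omega[\nu]\text{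 for some }(\mu,\nu)\in S\}$. $C^1(\mathbb R^{E^T}_{\ge0})$ means continuously differentiable up to the boundary. $H$ is extended to $\mathbb R^{E^{T,\Omega}}_{\ge0}$ by $H(i)=H(i|_{E^T})$, so $\nabla H=0$ on $E^\Omega$. For a graph $G'=(N',E')$, $\mathcal M\subseteq\mathbb R^{N'}$ and $H:\mathbb R^{E'}_{\ge0}\to\mathbb R$, $\operatorname{BP}(G',\mathcal M,H)=\operatorname{argmin}\{H(i): i\in\mathbb R^{E'}_{\ge0},\ \operatorname{div}i\in\mathcal M\}$. *)

theory Defs
  imports "HOL-Analysis.Analysis"
begin

text \<open>A finite set \<open>X\<close> gives the function space \<open>\<real>\<^sup>X\<close>, represented by the extensional functions
  \<open>X \<rightarrow>\<^sub>E UNIV\<close>; its topology is the one induced by the product topology of the function type.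
  The space \<open>\<real>\<^sup>m\<close> is \<open>\<real>\<^sup>X\<close> for \<open>X = {..<m}\<close>, so that \<open>m = 0\<close> is allowed.\<close>

abbreviation rfun :: "'a set \<Rightarrow> ('a \<Rightarrow> real) set" where
  "rfun X \<equiv> X \<rightarrow>\<^sub>E UNIV"

abbreviation orthant :: "'a set \<Rightarrow> ('a \<Rightarrow> real) set" where
  "orthant X \<equiv> X \<rightarrow>\<^sub>E {0..}"

definition prob_on :: "'a set \<Rightarrow> ('a \<Rightarrow> real) set" where
  "prob_on N = {\<mu> \<in> rfun N. (\<forall>x\<in>N. 0 \<le> \<mu> x) \<and> (\<Sum>x\<in>N. \<mu> x) = 1}"

subsection \<open>Linear maps between function spaces\<close>

definition linear_rfun :: "'a set \<Rightarrow> 'b set \<Rightarrow> (('a \<Rightarrow> real) \<Rightarrow> ('b \<Rightarrow> real)) \<Rightarrow> bool" where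
  "linear_rfun X Y A \<longleftrightarrow>
     A \<in> rfun X \<rightarrow> rfun Y \<and>
     (\<forall>f\<in>rfun X. \<forall>g\<in>rfun X. A (\<lambda>x\<in>X. f x + g x) = (\<lambda>y\<in>Y. A f y + A g y)) \<and>
     (\<forall>c. \<forall>f\<in>rfun X. A (\<lambda>x\<in>X. c * f x) = (\<lambda>y\<in>Y. c * A f y))"

definition unit_fun :: "'a set \<Rightarrow> 'a \<Rightarrow> 'a \<Rightarrow> real" where
  "unit_fun X x = (\<lambda>z\<in>X. if z = x then 1 else 0)"

text \<open>The transpose with respect to the standard inner products, given by the transposed matrix;
  see \<open>transpose_rfun_adjoint\<close> below.\<close>

definition transpose_rfun ::
  "'a set \<Rightarrow> 'b set \<Rightarrow> (('a \<Rightarrow> real) \<Rightarrow> ('b \<Rightarrow> real)) \<Rightarrow> ('b \<Rightarrow> real) \<Rightarrow> ('a \<Rightarrow> real)" where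
  "transpose_rfun X Y A w = (\<lambda>x\<in>X. \<Sum>y\<in>Y. A (unit_fun X x) y * w y)"

lemma linear_rfun_expand:
  assumes A: "linear_rfun X Y A" and X: "finite X" and f: "f \<in> rfun X" and y: "y \<in> Y"
  shows "A f y = (\<Sum>x\<in>X. f x * A (unit_fun X x) y)"
proof -
  have add: "A (\<lambda>x\<in>X. f x + g x) = (\<lambda>y\<in>Y. A f y + A g y)"
    if "f \<in> rfun X" "g \<in> rfun X" for f g
    using A that unfolding linear_rfun_def by blast
  have scale: "A (\<lambda>x\<in>X. c * f x) = (\<lambda>y\<in>Y. c * A f y)" if "f \<in> rfun X" for c f
    using A that unfolding linear_rfun_def by blast
  have unit: "unit_fun X x \<in> rfun X" for x
    by (simp add: unit_fun_def)
  have "A (\<lambda>x\<in>X. if x \<in> F then f x else 0) y = (\<Sum>x\<in>F. f x * A (unit_fun X x) y)"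
    if "finite F" "F \<subseteq> X" for F
    using that
  proof (induction F rule: finite_induct)
    case empty
    have "(\<lambda>x\<in>X. if x \<in> {} then f x else 0) = (\<lambda>x\<in>X. 0 * f x)"
      by auto
    then show ?case
      using y by (simp only:) (subst scale[OF f]; simp)
  next
    case (insert a F)
    let ?g = "\<lambda>x\<in>X. if x \<in> F then f x else 0" and ?h = "\<lambda>x\<in>X. f a * unit_fun X a x"
    have "(\<lambda>x\<in>X. if x \<in> insert a F then f x else 0) = (\<lambda>x\<in>X. ?g x + ?h x)"
      using insert.hyps by (auto simp: unit_fun_def fun_eq_iff)
    then have "A (\<lambda>x\<in>X. if x \<in> insert a F then f x else 0) y = A ?g y + A ?h y"
      using y by (simp only:) (subst add; simp)
    also have "A ?h y = f a * A (unit_fun X a) y"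
      using y by (subst scale[OF unit]) simp
    finally show ?case
      using insert by simp
  qed
  note this[OF X order_refl]
  moreover have "(\<lambda>x\<in>X. if x \<in> X then f x else 0) = f"
    using f by (auto simp: fun_eq_iff PiE_iff extensional_def)
  ultimately show ?thesis
    by simp
qed

lemma transpose_rfun_adjoint:
  assumes "linear_rfun X Y A" "finite X" "f \<in> rfun X"
  shows "(\<Sum>y\<in>Y. A f y * w y) = (\<Sum>x\<in>X. f x * transpose_rfun X Y A w x)"
proof -
  have "(\<Sum>y\<in>Y. A f y * w y) = (\<Sum>y\<in>Y. \<Sum>x\<in>X. f x * A (unit_fun X x) y * w y)"
    by (rule sum.cong) (auto simp: linear_rfun_expand[OF assms] sum_distrib_right)
  also have "\<dots> = (\<Sum>x\<in>X. \<Sum>y\<in>Y. f x * A (unit_fun X x) y * w y)"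
    by (rule sum.swap)
  also have "\<dots> = (\<Sum>x\<in>X. f x * transpose_rfun X Y A w x)"
    by (rule sum.cong) (auto simp: transpose_rfun_def sum_distrib_left mult.assoc)
  finally show ?thesis .
qed

subsection \<open>Differentiability on the closed orthant\<close>

text \<open>\<open>has_gradient X H i g\<close>: Frechet differentiability of \<open>H\<close> at \<open>i\<close> relative to the closed
  orthant of \<open>\<real>\<^sup>X\<close>. It is spelled out because the function type is not a normed space.\<close>

definition has_gradient ::
  "'e set \<Rightarrow> (('e \<Rightarrow> real) \<Rightarrow> real) \<Rightarrow> ('e \<Rightarrow> real) \<Rightarrow> ('e \<Rightarrow> real) \<Rightarrow> bool" where
  "has_gradient X H i g \<longleftrightarrow> g \<in> rfun X \<and>
     ((\<lambda>j. (H j - H i - (\<Sum>e\<in>X. g e * (j e - i e))) / L2_set (\<lambda>e. j e - i e) X) \<longlongrightarrow> 0)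
       (at i within orthant X)"

text \<open>The gradient is unique also at boundary points; see \<open>gradient_eqI\<close>.\<close>

definition gradient :: "'e set \<Rightarrow> (('e \<Rightarrow> real) \<Rightarrow> real) \<Rightarrow> ('e \<Rightarrow> real) \<Rightarrow> ('e \<Rightarrow> real)" where
  "gradient X H i = (THE g. has_gradient X H i g)"

definition C1_orthant :: "'e set \<Rightarrow> (('e \<Rightarrow> real) \<Rightarrow> real) \<Rightarrow> bool" where
  "C1_orthant X H \<longleftrightarrow>
     (\<exists>g. (\<forall>i\<in>orthant X. has_gradient X H i (g i)) \<and> continuous_on (orthant X) g)"

definition convex_orthant :: "'e set \<Rightarrow> (('e \<Rightarrow> real) \<Rightarrow> real) \<Rightarrow> bool" where
  "convex_orthant X H \<longleftrightarrow>
     (\<forall>i\<in>orthant X. \<forall>j\<in>orthant X. \<forall>s\<in>{0..1}.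
        H (\<lambda>e\<in>X. (1 - s) * i e + s * j e) \<le> (1 - s) * H i + s * H j)"

lemma has_gradient_unique:
  assumes X: "finite X" and i: "i \<in> orthant X"
    and g: "has_gradient X H i g" and h: "has_gradient X H i h"
  shows "g = h"
proof -
  have "g e = h e" if e: "e \<in> X" for e
  proof -
    define j where "j n = i(e := i e + 1 / real (Suc n))" for n
    have jO: "j n \<in> orthant X" and ji: "j n \<noteq> i" for n
      using i e by (auto simp: j_def PiE_iff extensional_def fun_eq_iff add_nonneg_nonneg)
    have "(\<lambda>n. j n x) \<longlonglongrightarrow> i x" for x
    proof (cases "x = e")
      case True
      have "(\<lambda>n. i e + 1 / real (Suc n)) \<longlonglongrightarrow> i e + 0"
        by (intro tendsto_add tendsto_const LIMSEQ_Suc lim_1_over_n)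
      then show ?thesis using True by (simp add: j_def)
    qed (simp add: j_def)
    then have "j \<longlonglongrightarrow> i"
      using limitin_componentwise[of "\<lambda>_. euclideanreal" UNIV j i sequentially]
      by (simp add: euclidean_product_topology)
    then have lim: "filterlim j (at i within orthant X) sequentially"
      using jO ji by (simp add: filterlim_at)
    let ?Q = "\<lambda>g j. (H j - H i - (\<Sum>e\<in>X. g e * (j e - i e))) / L2_set (\<lambda>e. j e - i e) X"
    have "(?Q g \<longlongrightarrow> 0) (at i within orthant X)" "(?Q h \<longlongrightarrow> 0) (at i within orthant X)"
      using g h by (simp_all add: has_gradient_def)
    then have "((\<lambda>j. ?Q h j - ?Q g j) \<longlongrightarrow> 0 - 0) (at i within orthant X)"
      by (intro tendsto_diff)
    then have "(\<lambda>n. ?Q h (j n) - ?Q g (j n)) \<longlonglongrightarrow> 0"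
      using filterlim_compose[OF _ lim] by force
    moreover have "?Q h (j n) - ?Q g (j n) = g e - h e" for n
    proof -
      have d: "j n x - i x = (if x = e then 1 / real (Suc n) else 0)" for x
        by (simp add: j_def)
      have s: "(\<Sum>x\<in>X. k x * (j n x - i x)) = k e / real (Suc n)" for k
        unfolding d using X e by (simp add: if_distrib cong: if_cong)
      have "L2_set (\<lambda>x. j n x - i x) X = 1 / real (Suc n)"
        unfolding d L2_set_def using X e
        by (simp add: if_distrib[where f = "\<lambda>x. x ^ 2"] cong: if_cong)
      then show ?thesis
        unfolding s by (simp add: field_simps)
    qed
    ultimately have "(\<lambda>n::nat. g e - h e) \<longlonglongrightarrow> 0"
      by simp
    then show ?thesis
      by (simp add: LIMSEQ_const_iff)
  qed
  moreover have "g \<in> rfun X" "h \<in> rfun X"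
    using g h by (auto simp: has_gradient_def)
  ultimately show ?thesis
    by (meson PiE_ext)
qed

lemma gradient_eqI:
  assumes "finite X" "i \<in> orthant X" "has_gradient X H i g"
  shows "gradient X H i = g"
  unfolding gradient_def using assms has_gradient_unique by (metis (no_types) the_equality)

subsection \<open>Flows on directed graphs\<close>

text \<open>A directed graph is given by its vertex set \<open>V\<close> and its edge set \<open>E \<subseteq> V \<times> V\<close>; an edge \<open>e\<close>
  goes from \<open>fst e\<close> to \<open>snd e\<close>.\<close>

definition divg :: "'v set \<Rightarrow> ('v \<times> 'v) set \<Rightarrow> ('v \<times> 'v \<Rightarrow> real) \<Rightarrow> 'v \<Rightarrow> real" where
  "divg V E i = (\<lambda>x\<in>V. (\<Sum>e\<in>{e\<in>E. fst e = x}. i e) - (\<Sum>e\<in>{e\<in>E. snd e = x}. i e))"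

definition grad :: "('v \<times> 'v) set \<Rightarrow> ('v \<Rightarrow> real) \<Rightarrow> 'v \<times> 'v \<Rightarrow> real" where
  "grad E u = (\<lambda>e\<in>E. u (snd e) - u (fst e))"

definition BP :: "'v set \<times> ('v \<times> 'v) set \<Rightarrow> ('v \<Rightarrow> real) set \<Rightarrow> (('v \<times> 'v \<Rightarrow> real) \<Rightarrow> real)
    \<Rightarrow> ('v \<times> 'v \<Rightarrow> real) set" where
  "BP G M H = {i. is_arg_min H (\<lambda>j. j \<in> orthant (snd G) \<and> divg (fst G) (snd G) j \<in> M) i}"

subsection \<open>Extended graphs\<close>

datatype time = At nat | Omega

type_synonym 'a node = "'a \<times> time"
type_synonym 'a edge = "'a node \<times> 'a node"

definition nodesT :: "'a set \<Rightarrow> nat \<Rightarrow> 'a node set" where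
  "nodesT N T = N \<times> At ` {0..T}"

definition edgesT :: "('a \<times> 'a) set \<Rightarrow> nat \<Rightarrow> 'a edge set" where
  "edgesT E T = {((x, At (t - 1)), (y, At t)) | x y t. (x, y) \<in> E \<and> t \<in> {1..T}}"

definition nodesTO :: "'a set \<Rightarrow> nat \<Rightarrow> 'a node set" where
  "nodesTO N T = nodesT N T \<union> N \<times> {Omega}"

definition edgesTO :: "'a set \<Rightarrow> ('a \<times> 'a) set \<Rightarrow> nat \<Rightarrow> 'a edge set" where
  "edgesTO N E T = edgesT E T \<union> {((x, At t), (x, Omega)) | x t. x \<in> N \<and> t \<in> {1..T}}"

definition graphTO :: "'a set \<Rightarrow> ('a \<times> 'a) set \<Rightarrow> nat \<Rightarrow> 'a node set \<times> 'a edge set" where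
  "graphTO N E T = (nodesTO N T, edgesTO N E T)"

text \<open>The injections of \<open>\<real>\<^sup>N\<close> at the initial time (\<open>s = At 0\<close>) and at the terminal layer
  (\<open>s = Omega\<close>), and their transposes.\<close>

definition inj_at :: "'a set \<Rightarrow> nat \<Rightarrow> time \<Rightarrow> ('a \<Rightarrow> real) \<Rightarrow> 'a node \<Rightarrow> real" where
  "inj_at N T s \<mu> = (\<lambda>p\<in>nodesTO N T. if snd p = s then \<mu> (fst p) else 0)"

definition inj_at_t :: "'a set \<Rightarrow> time \<Rightarrow> ('a node \<Rightarrow> real) \<Rightarrow> 'a \<Rightarrow> real" where
  "inj_at_t N s f = (\<lambda>x\<in>N. f (x, s))"

abbreviation "iota0 N T \<equiv> inj_at N T (At 0)"
abbreviation "iotaO N T \<equiv> inj_at N T Omega"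
abbreviation "iota0_t N \<equiv> inj_at_t N (At 0)"
abbreviation "iotaO_t N \<equiv> inj_at_t N Omega"

lemma inj_at_t_eq_transpose_rfun:
  assumes N: "finite N" and s: "s \<in> {At 0, Omega}"
  shows "transpose_rfun N (nodesTO N T) (inj_at N T s) f = inj_at_t N s f"
proof -
  have fin: "finite (nodesTO N T)"
    using N by (simp add: nodesTO_def nodesT_def)
  have "(\<Sum>p\<in>nodesTO N T. inj_at N T s (unit_fun N x) p * f p) = f (x, s)" if x: "x \<in> N" for x
  proof -
    have mem: "(x, s) \<in> nodesTO N T"
      using x s by (auto simp: nodesTO_def nodesT_def)
    have "(\<Sum>p\<in>nodesTO N T. inj_at N T s (unit_fun N x) p * f p)
        = (\<Sum>p\<in>nodesTO N T. if p = (x, s) then f p else 0)"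
      by (rule sum.cong) (auto simp: inj_at_def unit_fun_def nodesTO_def nodesT_def)
    then show ?thesis
      using fin mem by simp
  qed
  then show ?thesis
    by (auto simp: transpose_rfun_def inj_at_t_def)
qed

definition MOmega :: "'a set \<Rightarrow> nat \<Rightarrow> (('a \<Rightarrow> real) \<times> ('a \<Rightarrow> real)) set \<Rightarrow> ('a node \<Rightarrow> real) set" where
  "MOmega N T S = {f \<in> rfun (nodesTO N T). \<exists>(\<mu>, \<nu>)\<in>S.
      f = (\<lambda>p\<in>nodesTO N T. iota0 N T \<mu> p - iotaO N T \<nu> p)}"

definition ext_cost ::
  "('a \<times> 'a) set \<Rightarrow> nat \<Rightarrow> (('a edge \<Rightarrow> real) \<Rightarrow> real) \<Rightarrow> ('a edge \<Rightarrow> real) \<Rightarrow> real" where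
  "ext_cost E T H i = H (restrict i (edgesT E T))"

subsection \<open>Admissible marginals and the optimality system\<close>

definition marginal_set ::
  "'a set \<Rightarrow> nat \<Rightarrow> (('a \<Rightarrow> real) \<Rightarrow> nat \<Rightarrow> real) \<Rightarrow> (('a \<Rightarrow> real) \<Rightarrow> nat \<Rightarrow> real) \<Rightarrow> (nat \<Rightarrow> real)
    \<Rightarrow> nat \<Rightarrow> (('a \<Rightarrow> real) \<Rightarrow> nat \<Rightarrow> real) \<Rightarrow> (('a \<Rightarrow> real) \<Rightarrow> nat \<Rightarrow> real) \<Rightarrow> (nat \<Rightarrow> real)
    \<Rightarrow> (('a \<Rightarrow> real) \<times> ('a \<Rightarrow> real)) set" where
  "marginal_set N m1 A1m A1p b1 m2 A2m A2p b2 =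
     {(\<mu>, \<nu>) \<in> rfun N \<times> rfun N.
        (\<forall>k<m1. A1m \<mu> k + A1p \<nu> k = b1 k) \<and> (\<forall>k<m2. A2m \<mu> k + A2p \<nu> k \<ge> b2 k)}"

text \<open>The first two conjuncts couple the values of \<open>u\<close> at time \<open>0\<close> and at \<open>\<Omega>\<close> to the
  multipliers \<open>u1\<close>, \<open>u2\<close>; the remaining four are the system proper.\<close>

definition optimality_system ::
  "'a set \<Rightarrow> ('a \<times> 'a) set \<Rightarrow> nat
    \<Rightarrow> nat \<Rightarrow> (('a \<Rightarrow> real) \<Rightarrow> nat \<Rightarrow> real) \<Rightarrow> (('a \<Rightarrow> real) \<Rightarrow> nat \<Rightarrow> real) \<Rightarrow> (nat \<Rightarrow> real)
    \<Rightarrow> nat \<Rightarrow> (('a \<Rightarrow> real) \<Rightarrow> nat \<Rightarrow> real) \<Rightarrow> (('a \<Rightarrow> real) \<Rightarrow> nat \<Rightarrow> real) \<Rightarrow> (nat \<Rightarrow> real)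
    \<Rightarrow> (('a edge \<Rightarrow> real) \<Rightarrow> real) \<Rightarrow> ('a edge \<Rightarrow> real)
    \<Rightarrow> ('a node \<Rightarrow> real) \<Rightarrow> (nat \<Rightarrow> real) \<Rightarrow> (nat \<Rightarrow> real) \<Rightarrow> bool" where
  "optimality_system N E T m1 A1m A1p b1 m2 A2m A2p b2 H i u u1 u2 \<longleftrightarrow>
    (let d = divg (nodesTO N T) (edgesTO N E T) i;
         DH = gradient (edgesTO N E T) (ext_cost E T H) i;
         Du = grad (edgesTO N E T) u
     in (\<forall>x\<in>N. iota0_t N u x =
           transpose_rfun N {..<m1} A1m u1 x - transpose_rfun N {..<m2} A2m u2 x) \<and>
        (\<forall>x\<in>N. iotaO_t N u x =
           - (transpose_rfun N {..<m1} A1p u1 x - transpose_rfun N {..<m2} A2p u2 x)) \<and>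
        (\<forall>e\<in>edgesTO N E T. min (i e) (DH e - Du e) = 0) \<and>
        (\<forall>x\<in>N. \<forall>t\<in>{1..T}. d (x, At t) = 0) \<and>
        (\<forall>k<m2. min (A2m (iota0_t N d) k - A2p (iotaO_t N d) k - b2 k) (u2 k) = 0) \<and>
        (\<forall>k<m1. A1m (iota0_t N d) k - A1p (iotaO_t N d) k = b1 k))"

end

theory Submission
  imports Defs
begin

text \<open>Necessity is the Karush-Kuhn-Tucker theorem for affine constraints, for which no constraint
  qualification is needed: a minimizer has a nonnegative derivative in every direction satisfying
  the equality constraints and the active inequality constraints, and Farkas' lemma writes the
  gradient as a combination of the constraint functionals. Every constraint other than \<open>0 \<le> i\<close> has
  the form \<open>\<langle>F, div i\<rangle> = \<langle>-DF, i\<rangle>\<close> for a function \<open>F\<close> on the nodes, so \<open>-u\<close> is the combination of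
  these \<open>F\<close> with the multipliers as coefficients. Conversely, for convex \<open>H\<close>,
  \<open>H j - H i \<ge> \<langle>\<nabla>H i, j - i\<rangle> \<ge> \<langle>Du, j - i\<rangle> = \<langle>u, div i - div j\<rangle>\<close>, and the last pairing is
  nonnegative by complementary slackness.\<close>

subsection \<open>Farkas' lemma\<close>

text \<open>The proof is Bartl's induction on the number of inequalities. It is purely algebraic,
  so that no closedness of finitely generated cones, and no norm on \<open>\<real>\<^sup>X\<close>, is needed.\<close>

lemma farkas:
  fixes a :: "'k \<Rightarrow> 'e \<Rightarrow> real" and c :: "'e \<Rightarrow> real"
  assumes K: "finite K" and X: "finite X"
    and cone: "\<And>x. (\<And>k. k \<in> K \<Longrightarrow> 0 \<le> (\<Sum>e\<in>X. a k e * x e)) \<Longrightarrow> 0 \<le> (\<Sum>e\<in>X. c e * x e)"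
  shows "\<exists>l. (\<forall>k\<in>K. 0 \<le> l k) \<and> (\<forall>e\<in>X. c e = (\<Sum>k\<in>K. l k * a k e))"
  using K cone
proof (induction K arbitrary: a c rule: finite_induct)
  case empty
  \<comment> \<open>Without inequalities every vector is admissible. Testing the hypothesis with
    \<open>-c\<close> leaves only \<open>c = 0\<close> on \<open>X\<close>, which is the empty
    combination.\<close>
  from empty[of "\<lambda>e. - c e"] have "(\<Sum>e\<in>X. c e * c e) \<le> 0"
    by (simp add: sum_negf)
  then have "(\<Sum>e\<in>X. c e * c e) = 0"
    by (intro antisym sum_nonneg) auto
  then have "\<forall>e\<in>X. c e * c e = 0"
    using X by (subst (asm) sum_nonneg_eq_0_iff) auto
  then show ?case by auto
next
  case (insert k0 K)
  let ?i = "\<lambda>f x. \<Sum>e\<in>X. f e * x e :: real"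
  show ?case
  proof (cases "\<forall>x. (\<forall>k\<in>K. 0 \<le> ?i (a k) x) \<longrightarrow> 0 \<le> ?i c x")
    case True
    then obtain l where l: "\<forall>k\<in>K. 0 \<le> l k" "\<forall>e\<in>X. c e = (\<Sum>k\<in>K. l k * a k e)"
      using insert.IH[of a c] by blast
    have "(\<Sum>k\<in>K. (l(k0 := 0)) k * a k e) = (\<Sum>k\<in>K. l k * a k e)" for e
      using insert.hyps by (intro sum.cong) auto
    then show ?thesis
      using l insert.hyps by (intro exI[of _ "l(k0 := 0)"]) simp
  next
    case False
    then obtain y where y: "\<forall>k\<in>K. 0 \<le> ?i (a k) y" "?i c y < 0"
      by (auto simp: not_le)
    \<comment> \<open>The vector \<open>y\<close> satisfies the inequalities in \<open>K\<close> but
      not the conclusion, so it can only be the inequality \<open>k0\<close> that excludes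
      it.\<close>
    have neg: "?i (a k0) y < 0"
      using insert.prems[of y] y by force
    \<comment> \<open>Positive rescaling of \<open>y\<close> with \<open>a k0\<close> normalized to
      \<open>-1\<close>. Adding \<open>?i (a k0) x\<close> times \<open>x0\<close> to
      \<open>x\<close> therefore lands in the kernel of \<open>a k0\<close>.\<close>
    define x0 where "x0 e = y e / - ?i (a k0) y" for e
    have x0: "?i f x0 = ?i f y / - ?i (a k0) y" for f
      unfolding x0_def by (simp add: sum_divide_distrib sum_negf)
    have a0: "?i (a k0) x0 = -1" and ak: "\<forall>k\<in>K. 0 \<le> ?i (a k) x0" and c0: "?i c x0 < 0"
      using neg y unfolding x0 by (auto simp: divide_simps)
    have lin: "?i f (\<lambda>e. x e + t * y e) = ?i f x + t * ?i f y" for f x t y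
      by (simp add: distrib_left sum.distrib sum_distrib_left mult.left_commute)
    have lin': "?i (\<lambda>e. f e + t * h e) x = ?i f x + t * ?i h x" for f h t x
      by (simp add: distrib_right sum.distrib sum_distrib_left mult.assoc)
    \<comment> \<open>\<open>P f\<close> is \<open>f\<close> composed with the projection onto the kernel of \<open>a k0\<close> along \<open>x0\<close>.\<close>
    define P where "P f e = f e + ?i f x0 * a k0 e" for f e
    have P: "?i (P f) x = ?i f (\<lambda>e. x e + ?i (a k0) x * x0 e)" for f x
      unfolding P_def lin lin' by simp
    \<comment> \<open>The projected vector meets the inequality \<open>k0\<close> with equality, so
      the hypothesis for \<open>insert k0 K\<close> becomes one for \<open>K\<close> with the
      projected functionals.\<close>
    have "\<exists>l. (\<forall>k\<in>K. 0 \<le> l k) \<and> (\<forall>e\<in>X. P c e = (\<Sum>k\<in>K. l k * P (a k) e))"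
    proof (rule insert.IH)
      fix x assume x: "\<And>k. k \<in> K \<Longrightarrow> 0 \<le> ?i (P (a k)) x"
      let ?y = "\<lambda>e. x e + ?i (a k0) x * x0 e"
      have "?i (a k0) ?y = ?i (a k0) x + ?i (a k0) x * ?i (a k0) x0"
        by (rule lin)
      then have "0 \<le> ?i (a k) ?y" if "k \<in> insert k0 K" for k
        using that x a0 by (auto simp: P)
      from insert.prems[OF this] show "0 \<le> ?i (P c) x"
        by (simp add: P)
    qed
    then obtain l where l: "\<forall>k\<in>K. 0 \<le> l k" "\<forall>e\<in>X. P c e = (\<Sum>k\<in>K. l k * P (a k) e)"
      by blast
    \<comment> \<open>Expanding \<open>P\<close> in the representation of \<open>P c\<close> and
      collecting the multiples of \<open>a k0\<close> gives this coefficient. It is nonnegative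
      because \<open>x0\<close> satisfies the inequalities in \<open>K\<close> and
      \<open>?i c x0 < 0\<close>.\<close>
    define l' where "l' = l(k0 := (\<Sum>k\<in>K. l k * ?i (a k) x0) - ?i c x0)"
    have "0 \<le> (\<Sum>k\<in>K. l k * ?i (a k) x0)"
      using l(1) ak by (intro sum_nonneg) auto
    then have "\<forall>k\<in>insert k0 K. 0 \<le> l' k"
      using l(1) c0 by (auto simp: l'_def)
    moreover have "c e = (\<Sum>k\<in>insert k0 K. l' k * a k e)" if "e \<in> X" for e
    proof -
      have "(\<Sum>k\<in>K. l' k * a k e) = (\<Sum>k\<in>K. l k * a k e)"
        using insert.hyps by (intro sum.cong) (auto simp: l'_def)
      moreover have "c e + ?i c x0 * a k0 e
          = (\<Sum>k\<in>K. l k * a k e) + (\<Sum>k\<in>K. l k * ?i (a k) x0) * a k0 e"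
        using l(2) that unfolding P_def
        by (simp add: distrib_left sum.distrib sum_distrib_right mult.assoc)
      ultimately show ?thesis
        using insert.hyps by (simp add: l'_def algebra_simps)
    qed
    ultimately show ?thesis by blast
  qed
qed

text \<open>An equality is a pair of opposite inequalities. Its multiplier is the difference of the
  two nonnegative ones and so has free sign.\<close>

lemma farkas_eq:
  fixes a :: "'k \<Rightarrow> 'e \<Rightarrow> real" and b :: "'l \<Rightarrow> 'e \<Rightarrow> real" and c :: "'e \<Rightarrow> real"
  assumes K: "finite K" and L: "finite L" and X: "finite X"
    and cone: "\<And>x. (\<And>k. k \<in> K \<Longrightarrow> 0 \<le> (\<Sum>e\<in>X. a k e * x e)) \<Longrightarrow>
      (\<And>l. l \<in> L \<Longrightarrow> (\<Sum>e\<in>X. b l e * x e) = 0) \<Longrightarrow> 0 \<le> (\<Sum>e\<in>X. c e * x e)"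
  shows "\<exists>w v. (\<forall>k\<in>K. 0 \<le> w k) \<and>
    (\<forall>e\<in>X. c e = (\<Sum>k\<in>K. w k * a k e) + (\<Sum>l\<in>L. v l * b l e))"
proof -
  define f where "f = case_sum a (case_sum b (\<lambda>l e. - b l e))"
  have fs: "f (Inl k) = a k" "f (Inr (Inl l)) = b l" "f (Inr (Inr l)) = (\<lambda>e. - b l e)" for k l
    by (simp_all add: f_def)
  have "\<exists>w. (\<forall>k\<in>K <+> (L <+> L). 0 \<le> w k) \<and>
      (\<forall>e\<in>X. c e = (\<Sum>k\<in>K <+> (L <+> L). w k * f k e))"
  proof (rule farkas)
    fix x assume x: "\<And>k. k \<in> K <+> (L <+> L) \<Longrightarrow> 0 \<le> (\<Sum>e\<in>X. f k e * x e)"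
    show "0 \<le> (\<Sum>e\<in>X. c e * x e)"
    proof (rule cone)
      show "0 \<le> (\<Sum>e\<in>X. a k e * x e)" if "k \<in> K" for k
        using x[of "Inl k"] that by (simp add: fs InlI)
      show "(\<Sum>e\<in>X. b l e * x e) = 0" if "l \<in> L" for l
        using x[of "Inr (Inl l)"] x[of "Inr (Inr l)"] that by (simp add: fs InlI InrI sum_negf)
    qed
  qed (use K L X in auto)
  then obtain w where w: "\<forall>k\<in>K <+> (L <+> L). 0 \<le> w k"
    "\<forall>e\<in>X. c e = (\<Sum>k\<in>K <+> (L <+> L). w k * f k e)"
    by blast
  have "c e = (\<Sum>k\<in>K. w (Inl k) * a k e)
      + (\<Sum>l\<in>L. (w (Inr (Inl l)) - w (Inr (Inr l))) * b l e)" if "e \<in> X" for e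
    unfolding bspec[OF w(2) that] using K L
    by (simp add: sum.Plus fs o_def left_diff_distrib sum_subtractf sum_negf)
  moreover have "\<forall>k\<in>K. 0 \<le> w (Inl k)"
    using w(1) by auto
  ultimately show ?thesis
    by (intro exI[of _ "\<lambda>k. w (Inl k)"] exI[of _ "\<lambda>l. w (Inr (Inl l)) - w (Inr (Inr l))"]) simp
qed

subsection \<open>Optimality conditions on the orthant\<close>

text \<open>The orthant is convex, so the segment from \<open>i\<close> to \<open>j\<close>
  approaches \<open>i\<close> inside it, at distance \<open>s\<close> times that of
  \<open>j\<close>. Composing the Frechet quotient with this path reduces differentiability to a
  limit in one real variable.\<close>

lemma has_gradient_directional:
  assumes i: "i \<in> orthant X" and j: "j \<in> orthant X" and X: "finite X" and g: "has_gradient X H i g"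
  shows "((\<lambda>s. (H (\<lambda>e\<in>X. (1 - s) * i e + s * j e) - H i) / s) \<longlongrightarrow> (\<Sum>e\<in>X. g e * (j e - i e)))
    (at_right 0)"
proof (cases "j = i")
  case True
  have "(\<lambda>e\<in>X. (1 - s) * i e + s * j e) = i" for s
    using i True by (auto simp: fun_eq_iff PiE_iff extensional_def algebra_simps)
  then show ?thesis using True by simp
next
  case False
  define p where "p s = (\<lambda>e\<in>X. (1 - s) * i e + s * j e)" for s
  define D where "D = L2_set (\<lambda>e. j e - i e) X"
  have "\<exists>e\<in>X. j e \<noteq> i e"
    using i j False by (metis PiE_ext)
  then have "D \<noteq> 0"
    unfolding D_def using X by (simp add: L2_set_eq_0_iff)
  then have D: "D > 0"
    by (simp add: D_def order_less_le)
  have ev: "eventually (\<lambda>s. 0 < s \<and> s < (1::real)) (at_right 0)"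
    by (simp add: eventually_at_right_field) (auto intro: exI[of _ 1])
  have pO: "p s \<in> orthant X" if "0 < s" "s < 1" for s
    using i j that by (auto simp: p_def PiE_iff)
  have d: "L2_set (\<lambda>e. p s e - i e) X = s * D" if "0 < s" for s
  proof -
    have "L2_set (\<lambda>e. p s e - i e) X = L2_set (\<lambda>e. s * (j e - i e)) X"
      by (rule L2_set_cong) (auto simp: p_def algebra_simps)
    then show ?thesis
      using that by (simp add: D_def L2_set_right_distrib)
  qed
  have "continuous_on UNIV p"
  proof (rule continuous_on_coordinatewise_then_product)
    show "continuous_on UNIV (\<lambda>s. p s e)" for e
      by (cases "e \<in> X") (auto simp: p_def intro!: continuous_intros)
  qed
  then have "(p \<longlongrightarrow> p 0) (at 0)"
    by (simp add: continuous_on_def)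
  then have "(p \<longlongrightarrow> p 0) (at_right 0)"
    by (rule tendsto_within_subset) auto
  moreover have "p 0 = i"
    using i by (auto simp: p_def fun_eq_iff PiE_iff extensional_def)
  ultimately have "(p \<longlongrightarrow> i) (at_right 0)"
    by simp
  \<comment> \<open>The filter \<open>at i within orthant X\<close> is punctured at
    \<open>i\<close>, so the path must avoid \<open>i\<close>. It does because its distance from
    \<open>i\<close> is \<open>s * D > 0\<close>.\<close>
  moreover have "eventually (\<lambda>s. p s \<in> orthant X \<and> p s \<noteq> i) (at_right 0)"
  proof (rule eventually_mono[OF ev])
    fix s :: real assume s: "0 < s \<and> s < 1"
    have "p s \<noteq> i"
    proof
      assume "p s = i"
      with d[of s] s D show False by (simp add: L2_set_def)
    qed
    with s pO show "p s \<in> orthant X \<and> p s \<noteq> i" by blast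
  qed
  ultimately have "filterlim p (at i within orthant X) (at_right 0)"
    by (simp add: filterlim_at)
  moreover have "((\<lambda>j. (H j - H i - (\<Sum>e\<in>X. g e * (j e - i e))) / L2_set (\<lambda>e. j e - i e) X) \<longlongrightarrow> 0)
       (at i within orthant X)"
    using g by (simp add: has_gradient_def)
  ultimately have "((\<lambda>s. (H (p s) - H i - (\<Sum>e\<in>X. g e * (p s e - i e))) / L2_set (\<lambda>e. p s e - i e) X)
      \<longlongrightarrow> 0) (at_right 0)"
    by (rule filterlim_compose[rotated])
  \<comment> \<open>The denominator is \<open>s * D\<close>. Multiplying by \<open>D\<close> and
    adding the linear part back turns the Frechet quotient into the difference quotient in
    \<open>s\<close>.\<close>
  then have "((\<lambda>s. (H (p s) - H i - (\<Sum>e\<in>X. g e * (p s e - i e))) / L2_set (\<lambda>e. p s e - i e) X * D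
      + (\<Sum>e\<in>X. g e * (j e - i e))) \<longlongrightarrow> 0 * D + (\<Sum>e\<in>X. g e * (j e - i e))) (at_right 0)"
    by (intro tendsto_intros)
  moreover have "eventually (\<lambda>s.
      (H (p s) - H i - (\<Sum>e\<in>X. g e * (p s e - i e))) / L2_set (\<lambda>e. p s e - i e) X * D
      + (\<Sum>e\<in>X. g e * (j e - i e)) = (H (p s) - H i) / s) (at_right 0)"
  proof (rule eventually_mono[OF ev])
    fix s :: real assume s: "0 < s \<and> s < 1"
    have "(\<Sum>e\<in>X. g e * (p s e - i e)) = s * (\<Sum>e\<in>X. g e * (j e - i e))"
      unfolding sum_distrib_left by (rule sum.cong) (auto simp: p_def algebra_simps)
    with s D d[of s] show "(H (p s) - H i - (\<Sum>e\<in>X. g e * (p s e - i e))) / L2_set (\<lambda>e. p s e - i e) X * D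
      + (\<Sum>e\<in>X. g e * (j e - i e)) = (H (p s) - H i) / s"
      by (simp add: field_simps)
  qed
  ultimately show ?thesis
    unfolding p_def[symmetric] by (simp add: tendsto_cong)
qed

text \<open>Convexity bounds every difference quotient along the segment by
  \<open>H j - H i\<close>, and the bound survives the limit.\<close>

lemma convex_orthant_gradient_le:
  assumes "finite X" "convex_orthant X H" "i \<in> orthant X" "j \<in> orthant X" "has_gradient X H i g"
  shows "(\<Sum>e\<in>X. g e * (j e - i e)) \<le> H j - H i"
proof (rule tendsto_upperbound[OF has_gradient_directional])
  have "eventually (\<lambda>s. 0 < s \<and> s < (1::real)) (at_right 0)"
    by (simp add: eventually_at_right_field) (auto intro: exI[of _ 1])
  then show "eventually (\<lambda>s. (H (\<lambda>e\<in>X. (1 - s) * i e + s * j e) - H i) / s \<le> H j - H i) (at_right 0)"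
  proof (rule eventually_mono)
    fix s :: real assume s: "0 < s \<and> s < 1"
    then have "H (\<lambda>e\<in>X. (1 - s) * i e + s * j e) \<le> (1 - s) * H i + s * H j"
      using assms by (auto simp: convex_orthant_def)
    with s show "(H (\<lambda>e\<in>X. (1 - s) * i e + s * j e) - H i) / s \<le> H j - H i"
      by (simp add: divide_simps) (simp add: algebra_simps)
  qed
qed (use assms in auto)

text \<open>The ignored coordinates contribute nothing to the gradient. Restriction is continuous
  and does not increase the Euclidean distance, so the remainder quotient over \<open>Y\<close> is
  dominated by the one over \<open>X\<close>.\<close>

lemma has_gradient_restrict:
  assumes Y: "finite Y" and XY: "X \<subseteq> Y" and i: "i \<in> orthant Y"
    and g: "has_gradient X H (restrict i X) g"
  shows "has_gradient Y (\<lambda>j. H (restrict j X)) i (\<lambda>e\<in>Y. if e \<in> X then g e else 0)"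
proof -
  let ?r = "\<lambda>j. restrict j X"
  let ?g = "\<lambda>e\<in>Y. if e \<in> X then g e else 0"
  define R where "R j = H j - H (?r i) - (\<Sum>e\<in>X. g e * (j e - ?r i e))" for j
  have X: "finite X" using XY Y by (rule finite_subset)
  have num: "H (?r j) - H (?r i) - (\<Sum>e\<in>Y. ?g e * (j e - i e)) = R (?r j)" for j
  proof -
    have "(\<Sum>e\<in>Y. ?g e * (j e - i e)) = (\<Sum>e\<in>X. g e * (j e - i e))"
      using XY Y by (intro sum.mono_neutral_cong_right) auto
    then show ?thesis by (simp add: R_def)
  qed
  have "((\<lambda>j. R (?r j) / L2_set (\<lambda>e. j e - i e) Y) \<longlongrightarrow> 0) (at i within orthant Y)"
  proof (rule tendstoI)
    fix \<epsilon> :: real assume \<epsilon>: "0 < \<epsilon>"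
    have "((\<lambda>j. R j / L2_set (\<lambda>e. j e - ?r i e) X) \<longlongrightarrow> 0) (at (?r i) within orthant X)"
      using g by (simp add: has_gradient_def R_def)
    from tendstoD[OF this \<epsilon>] obtain U where U: "open U" "?r i \<in> U"
      "\<And>j. j \<in> U \<Longrightarrow> j \<noteq> ?r i \<Longrightarrow> j \<in> orthant X \<Longrightarrow> \<bar>R j / L2_set (\<lambda>e. j e - ?r i e) X\<bar> < \<epsilon>"
      by (auto simp: eventually_at_topological)
    have "continuous_on UNIV ?r"
    proof (rule continuous_on_coordinatewise_then_product)
      show "continuous_on UNIV (\<lambda>j. ?r j e)" for e
        by (cases "e \<in> X") (auto intro: continuous_on_product_coordinates)
    qed
    then have "open (?r -` U)"
      using U(1) by (rule open_vimage[rotated])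
    moreover have "dist (R (?r j) / L2_set (\<lambda>e. j e - i e) Y) 0 < \<epsilon>"
      if j: "j \<in> ?r -` U" "j \<noteq> i" "j \<in> orthant Y" for j
    \<comment> \<open>Distinct points may have the same restriction. The punctured limit over
      \<open>X\<close> says nothing about them, but there the remainder is zero.\<close>
    proof (cases "?r j = ?r i")
      case True
      then show ?thesis using \<epsilon> by (simp add: R_def)
    next
      case False
      then obtain e where e: "e \<in> X" "j e \<noteq> i e"
        by (auto simp: fun_eq_iff restrict_def split: if_splits)
      let ?a = "L2_set (\<lambda>e. j e - i e) X" and ?b = "L2_set (\<lambda>e. j e - i e) Y"
      have "?a \<noteq> 0"
        using e X by (auto simp: L2_set_eq_0_iff)
      then have a: "0 < ?a"
        by (simp add: order_less_le)
      have "?a \<le> ?b"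
        unfolding L2_set_def using XY Y by (intro real_sqrt_le_mono sum_mono2) auto
      then have "\<bar>R (?r j)\<bar> / ?b \<le> \<bar>R (?r j)\<bar> / ?a"
        using a by (intro divide_left_mono) auto
      also have "L2_set (\<lambda>e. ?r j e - ?r i e) X = ?a"
        by (rule L2_set_cong) auto
      then have "\<bar>R (?r j)\<bar> / ?a < \<epsilon>"
        using U(3)[of "?r j"] False j XY by (auto simp: PiE_iff subset_iff)
      finally show ?thesis
        by (simp add: dist_real_def)
    qed
    ultimately show "eventually (\<lambda>j. dist (R (?r j) / L2_set (\<lambda>e. j e - i e) Y) 0 < \<epsilon>) (at i within orthant Y)"
      using U(2) unfolding eventually_at_topological by (intro exI[of _ "?r -` U"]) auto
  qed
  then show ?thesis
    unfolding has_gradient_def num by auto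
qed

section \<open>Karush-Kuhn-Tucker conditions for affine constraints\<close>

text \<open>Each \<open>min\<close> packs two signs and complementary slackness into one equation.
  The multiplier of the constraint \<open>0 \<le> i e\<close> gets no name: it is the second
  argument of the second \<open>min\<close>.\<close>

lemma kkt_orthant:
  fixes a :: "'k \<Rightarrow> 'e \<Rightarrow> real" and b :: "'l \<Rightarrow> 'e \<Rightarrow> real"
  assumes X: "finite X" and K: "finite K" and L: "finite L"
    and i: "i \<in> orthant X" and g: "has_gradient X H i g"
    and feas: "\<And>k. k \<in> K \<Longrightarrow> \<alpha> k \<le> (\<Sum>e\<in>X. a k e * i e)"
      "\<And>l. l \<in> L \<Longrightarrow> (\<Sum>e\<in>X. b l e * i e) = \<beta> l"
    and min: "\<And>j. j \<in> orthant X \<Longrightarrow> (\<And>k. k \<in> K \<Longrightarrow> \<alpha> k \<le> (\<Sum>e\<in>X. a k e * j e)) \<Longrightarrow>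
      (\<And>l. l \<in> L \<Longrightarrow> (\<Sum>e\<in>X. b l e * j e) = \<beta> l) \<Longrightarrow> H i \<le> H j"
  obtains w v where
    "\<And>k. k \<in> K \<Longrightarrow> min ((\<Sum>e\<in>X. a k e * i e) - \<alpha> k) (w k) = 0"
    "\<And>e. e \<in> X \<Longrightarrow> min (i e) (g e - (\<Sum>k\<in>K. w k * a k e) - (\<Sum>l\<in>L. v l * b l e)) = 0"
proof -
  \<comment> \<open>Only the active constraints restrict the direction of a small step; the others
    have slack to spare.\<close>
  define X0 where "X0 = {e \<in> X. i e = 0}"
  define K0 where "K0 = {k \<in> K. (\<Sum>e\<in>X. a k e * i e) = \<alpha> k}"
  have fin: "finite X0" "finite K0"
    using X K by (auto simp: X0_def K0_def)
  \<comment> \<open>\<open>Inl e'\<close> is the coordinate functional of an active sign constraint,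
    \<open>Inr k\<close> an affine inequality.\<close>
  define f where "f = case_sum (\<lambda>e' e. if e = e' then 1 else 0) a"
  have fs: "f (Inl e') e = (if e = e' then 1 else 0)" "f (Inr k) = a k" for e' e k
    by (simp_all add: f_def)
  have unit: "(\<Sum>e\<in>X. f (Inl e') e * x e) = x e'" if "e' \<in> X" for e' x
    unfolding fs using that X by (simp add: if_distrib[where f = "\<lambda>y. y * _"] cong: if_cong)
  have "\<exists>w v. (\<forall>k\<in>X0 <+> K0. 0 \<le> w k) \<and>
    (\<forall>e\<in>X. g e = (\<Sum>k\<in>X0 <+> K0. w k * f k e) + (\<Sum>l\<in>L. v l * b l e))"
  proof (rule farkas_eq)
    fix x
    assume x1: "\<And>k. k \<in> X0 <+> K0 \<Longrightarrow> 0 \<le> (\<Sum>e\<in>X. f k e * x e)"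
      and x2: "\<And>l. l \<in> L \<Longrightarrow> (\<Sum>e\<in>X. b l e * x e) = 0"
    have x0: "0 \<le> x e" if "e \<in> X0" for e
      using x1[of "Inl e"] that unit[of e x] by (auto simp: X0_def)
    have xk: "0 \<le> (\<Sum>e\<in>X. a k e * x e)" if "k \<in> K0" for k
      using x1[of "Inr k"] that by (auto simp: fs)
    \<comment> \<open>Positive slack survives a small step by continuity; zero slack survives if the
      direction does not decrease it.\<close>
    have step: "eventually (\<lambda>s. c + s * d \<ge> 0) (at_right 0)" if "c \<ge> 0" "c = 0 \<Longrightarrow> d \<ge> 0" for c d :: real
    proof (cases "c = 0")
      case True
      show ?thesis
        using eventually_at_right_less[of "0::real"] by eventually_elim (use True that in auto)
    next
      case False
      have "((\<lambda>s. c + s * d) \<longlongrightarrow> c + 0 * d) (at_right 0)"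
        by (intro tendsto_intros)
      then have "eventually (\<lambda>s. 0 < c + s * d) (at_right 0)"
        using False that by (intro order_tendstoD(1)) auto
      then show ?thesis by eventually_elim auto
    qed
    have lin: "(\<Sum>e\<in>X. h e * (\<lambda>e\<in>X. i e + s * x e) e) = (\<Sum>e\<in>X. h e * i e) + s * (\<Sum>e\<in>X. h e * x e)" for h s
      by (simp add: distrib_left sum.distrib sum_distrib_left mult.left_commute)
    have "eventually (\<lambda>s. \<forall>e\<in>X. i e + s * x e \<ge> 0) (at_right 0)"
      using i x0 by (intro eventually_ball_finite X ballI step) (auto simp: X0_def PiE_iff)
    moreover have "eventually (\<lambda>s. \<forall>k\<in>K. (\<Sum>e\<in>X. a k e * i e) - \<alpha> k + s * (\<Sum>e\<in>X. a k e * x e) \<ge> 0)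
        (at_right 0)"
      using feas(1) xk by (intro eventually_ball_finite K ballI step) (auto simp: K0_def)
    moreover note eventually_at_right_less[of "0::real"]
    ultimately have "eventually (\<lambda>s. 0 < s \<and> (\<forall>e\<in>X. i e + s * x e \<ge> 0) \<and>
        (\<forall>k\<in>K. (\<Sum>e\<in>X. a k e * i e) - \<alpha> k + s * (\<Sum>e\<in>X. a k e * x e) \<ge> 0)) (at_right 0)"
      by eventually_elim auto
    then obtain s where s: "0 < s" "\<forall>e\<in>X. i e + s * x e \<ge> 0"
      "\<forall>k\<in>K. (\<Sum>e\<in>X. a k e * i e) - \<alpha> k + s * (\<Sum>e\<in>X. a k e * x e) \<ge> 0"
      using eventually_happens'[OF trivial_limit_at_right_real] by blast
    \<comment> \<open>Since \<open>X\<close> and \<open>K\<close> are finite, one \<open>s\<close>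
      serves all constraints, and \<open>j\<close> is a feasible point in direction
      \<open>x\<close>. The whole segment from \<open>i\<close> to \<open>j\<close> is then
      feasible.\<close>
    define j where "j = (\<lambda>e\<in>X. i e + s * x e)"
    have j: "j \<in> orthant X" using s by (auto simp: j_def)
    have "0 \<le> (\<Sum>e\<in>X. g e * (j e - i e))"
    proof (rule tendsto_lowerbound[OF has_gradient_directional[OF i j X g]])
      have "eventually (\<lambda>r. 0 < r \<and> r < (1::real)) (at_right 0)"
        by (simp add: eventually_at_right_field) (auto intro: exI[of _ 1])
      then show "eventually (\<lambda>r. 0 \<le> (H (\<lambda>e\<in>X. (1 - r) * i e + r * j e) - H i) / r) (at_right 0)"
      proof (rule eventually_mono)
        fix r :: real assume r: "0 < r \<and> r < 1"
        let ?p = "\<lambda>e\<in>X. (1 - r) * i e + r * j e"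
        have p: "?p = (\<lambda>e\<in>X. i e + (r * s) * x e)"
          by (auto simp: j_def fun_eq_iff algebra_simps)
        have "H i \<le> H ?p"
        proof (rule min)
          show "?p \<in> orthant X"
            using r i j by (auto simp: PiE_iff)
          show "(\<Sum>e\<in>X. b l e * ?p e) = \<beta> l" if "l \<in> L" for l
            unfolding p lin using feas(2) x2 that by simp
          show "\<alpha> k \<le> (\<Sum>e\<in>X. a k e * ?p e)" if k: "k \<in> K" for k
          proof -
            let ?A = "\<Sum>e\<in>X. a k e * i e" and ?B = "\<Sum>e\<in>X. a k e * x e"
            \<comment> \<open>The slack at \<open>?p\<close> is the convex combination of the slacks
              at \<open>i\<close> and \<open>j\<close>.\<close>
            have "0 \<le> (1 - r) * (?A - \<alpha> k) + r * (?A - \<alpha> k + s * ?B)"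
              using feas(1)[OF k] s(3) k r
              by (intro add_nonneg_nonneg[OF mult_nonneg_nonneg mult_nonneg_nonneg]) auto
            also have "\<dots> = ?A + r * s * ?B - \<alpha> k"
              by (simp add: algebra_simps)
            finally show ?thesis
              unfolding p lin by simp
          qed
        qed
        with r show "0 \<le> (H ?p - H i) / r" by simp
      qed
    qed auto
    also have "(\<Sum>e\<in>X. g e * (j e - i e)) = s * (\<Sum>e\<in>X. g e * x e)"
      unfolding sum_distrib_left by (rule sum.cong) (auto simp: j_def algebra_simps)
    finally show "0 \<le> (\<Sum>e\<in>X. g e * x e)"
      using s(1) by (simp add: zero_le_mult_iff)
  qed (use fin X L in auto)
  then obtain w v where w: "\<forall>k\<in>X0 <+> K0. 0 \<le> w k"
    "\<forall>e\<in>X. g e = (\<Sum>k\<in>X0 <+> K0. w k * f k e) + (\<Sum>l\<in>L. v l * b l e)"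
    by blast
  \<comment> \<open>The value zero on inactive constraints is complementary slackness.\<close>
  define w' where "w' k = (if k \<in> K0 then w (Inr k) else 0)" for k
  show ?thesis
  proof (rule that[of w' v])
    show "min ((\<Sum>e\<in>X. a k e * i e) - \<alpha> k) (w' k) = 0" if "k \<in> K" for k
    proof (cases "k \<in> K0")
      case True
      then have "0 \<le> w (Inr k)" using w(1) by auto
      with True show ?thesis by (simp add: w'_def K0_def)
    next
      case False
      with feas(1)[OF that] show ?thesis by (simp add: w'_def)
    qed
    show "min (i e) (g e - (\<Sum>k\<in>K. w' k * a k e) - (\<Sum>l\<in>L. v l * b l e)) = 0" if e: "e \<in> X" for e
    proof -
      have "(\<Sum>k\<in>X0 <+> K0. w k * f k e)
          = (if e \<in> X0 then w (Inl e) else 0) + (\<Sum>k\<in>K0. w (Inr k) * a k e)"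
        using fin by (simp add: sum.Plus fs if_distrib[where f = "\<lambda>y. _ * y"] cong: if_cong)
      also have "(\<Sum>k\<in>K0. w (Inr k) * a k e) = (\<Sum>k\<in>K. w' k * a k e)"
        using K by (intro sum.mono_neutral_cong_left) (auto simp: K0_def w'_def)
      finally have "g e - (\<Sum>k\<in>K. w' k * a k e) - (\<Sum>l\<in>L. v l * b l e)
          = (if e \<in> X0 then w (Inl e) else 0)"
        using w(2) e by simp
      moreover have "0 \<le> w (Inl e)" if "e \<in> X0"
        using that w(1) by auto
      moreover have "0 \<le> i e"
        using i e by (auto simp: PiE_iff)
      ultimately show ?thesis
        using e by (cases "e \<in> X0") (auto simp: X0_def)
    qed
  qed
qed

lemma convex_orthant_restrict:
  assumes XY: "X \<subseteq> Y" and H: "convex_orthant X H"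
  shows "convex_orthant Y (\<lambda>j. H (restrict j X))"
  unfolding convex_orthant_def
proof (intro ballI)
  fix i j s assume *: "i \<in> orthant Y" "j \<in> orthant Y" "s \<in> {0..1::real}"
  have "restrict (\<lambda>e\<in>Y. (1 - s) * i e + s * j e) X
      = (\<lambda>e\<in>X. (1 - s) * restrict i X e + s * restrict j X e)"
    using XY by (auto simp: fun_eq_iff)
  moreover have "restrict i X \<in> orthant X" "restrict j X \<in> orthant X"
    using * XY by (auto simp: PiE_iff)
  ultimately show "H (restrict (\<lambda>e\<in>Y. (1 - s) * i e + s * j e) X)
      \<le> (1 - s) * H (restrict i X) + s * H (restrict j X)"
    using H *(3) unfolding convex_orthant_def by (simp only:)
qed

subsection \<open>Summation by parts and the extended graph\<close>

text \<open>Summation by parts: \<open>divg\<close> is the negative adjoint of \<open>grad\<close>.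
  It turns a constraint on the divergence into a linear functional of the flow.\<close>

lemma sum_divg:
  assumes V: "finite V" and E: "E \<subseteq> V \<times> V"
  shows "(\<Sum>x\<in>V. f x * divg V E i x) = (\<Sum>e\<in>E. - grad E f e * i e)"
proof -
  have fin: "finite E"
    using V E finite_subset by blast
  \<comment> \<open>Here \<open>h\<close> stands for either endpoint map, whose fibres over
    \<open>V\<close> partition the edges.\<close>
  have "(\<Sum>x\<in>V. f x * (\<Sum>e\<in>{e\<in>E. h e = x}. i e)) = (\<Sum>e\<in>E. f (h e) * i e)"
    if "h ` E \<subseteq> V" for h
  proof -
    have "(\<Sum>x\<in>V. f x * (\<Sum>e\<in>{e\<in>E. h e = x}. i e))
        = (\<Sum>x\<in>V. \<Sum>e\<in>{e\<in>E. h e = x}. f (h e) * i e)"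
      by (simp add: sum_distrib_left)
    also have "\<dots> = (\<Sum>e\<in>E. f (h e) * i e)"
      using fin V that by (rule sum.group)
    finally show ?thesis .
  qed
  from this[of fst] this[of snd] show ?thesis
    using E by (force simp: divg_def grad_def right_diff_distrib left_diff_distrib sum_subtractf)
qed

lemma finite_nodesTO: "finite N \<Longrightarrow> finite (nodesTO N T)"
  by (simp add: nodesTO_def nodesT_def)

lemma edgesTO_subset: "E \<subseteq> N \<times> N \<Longrightarrow> edgesTO N E T \<subseteq> nodesTO N T \<times> nodesTO N T"
  by (auto simp: edgesTO_def edgesT_def nodesTO_def nodesT_def)

lemma finite_edgesTO: "finite N \<Longrightarrow> E \<subseteq> N \<times> N \<Longrightarrow> finite (edgesTO N E T)"
  by (rule finite_subset[OF edgesTO_subset]) (simp_all add: finite_nodesTO)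

lemma sum_nodesTO:
  assumes N: "finite N"
  shows "(\<Sum>p\<in>nodesTO N T. h p)
    = (\<Sum>x\<in>N. h (x, At 0)) + (\<Sum>x\<in>N. \<Sum>t\<in>{1..T}. h (x, At t)) + (\<Sum>x\<in>N. h (x, Omega))"
proof -
  have "{0..T} = insert 0 {1..T}"
    by auto
  then have "nodesTO N T = N \<times> insert (At 0) (insert Omega (At ` {1..T}))"
    by (auto simp: nodesTO_def nodesT_def)
  then have "(\<Sum>p\<in>nodesTO N T. h p) = (\<Sum>x\<in>N. \<Sum>s\<in>insert (At 0) (insert Omega (At ` {1..T})). h (x, s))"
    by (simp add: sum.cartesian_product)
  also have "\<dots> = (\<Sum>x\<in>N. h (x, At 0) + (h (x, Omega) + (\<Sum>t\<in>{1..T}. h (x, At t))))"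
    by (intro sum.cong refl, subst sum.insert, simp, force, subst sum.insert)
      (auto simp: sum.reindex inj_on_def)
  finally show ?thesis
    by (simp add: sum.distrib add_ac)
qed

section \<open>Marginal constraints as functionals of the divergence\<close>

text \<open>The node function whose pairing with the divergence is row \<open>k\<close> of a
  marginal constraint. The values on \<open>unit_fun\<close> are matrix entries; the sign at
  \<open>Omega\<close> is there because the divergence in that layer is
  \<open>-\<nu>\<close>.\<close>

definition marginal_coeff :: "'a set \<Rightarrow> (('a \<Rightarrow> real) \<Rightarrow> nat \<Rightarrow> real) \<Rightarrow> (('a \<Rightarrow> real) \<Rightarrow> nat \<Rightarrow> real)
    \<Rightarrow> nat \<Rightarrow> 'a node \<Rightarrow> real" where
  "marginal_coeff N Am Ap k p = (case snd p of
     At t \<Rightarrow> if t = 0 then Am (unit_fun N (fst p)) k else 0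
   | Omega \<Rightarrow> - Ap (unit_fun N (fst p)) k)"

lemma sum_marginal_coeff:
  assumes N: "finite N" and k: "k \<in> Y" and A: "linear_rfun N Y Am" "linear_rfun N Y Ap"
  shows "(\<Sum>p\<in>nodesTO N T. marginal_coeff N Am Ap k p * d p)
    = Am (iota0_t N d) k - Ap (iotaO_t N d) k"
proof -
  have r: "inj_at_t N s d \<in> rfun N" for s
    by (simp add: inj_at_t_def)
  show ?thesis
    unfolding linear_rfun_expand[OF A(1) N r k] linear_rfun_expand[OF A(2) N r k] sum_nodesTO[OF N]
    by (simp add: marginal_coeff_def inj_at_t_def sum_negf mult.commute)
qed

lemma linear_rfun_minus:
  assumes "linear_rfun X Y A" "f \<in> rfun X" "y \<in> Y"
  shows "A (\<lambda>x\<in>X. - f x) y = - A f y"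
proof -
  have "A (\<lambda>x\<in>X. (-1) * f x) = (\<lambda>y\<in>Y. (-1) * A f y)"
    using assms unfolding linear_rfun_def by blast
  then show ?thesis
    using assms(3) by simp
qed

text \<open>The marginals can be read off from \<open>d\<close>: \<open>\<mu>\<close> is its initial
  layer and \<open>\<nu>\<close> its negated terminal layer. The existential in
  \<open>MOmega\<close> thus disappears, and linearity moves the sign out of \<open>A1p\<close> and
  \<open>A2p\<close>.\<close>

lemma MOmega_marginal_set_iff:
  assumes A: "linear_rfun N {..<m1} A1p" "linear_rfun N {..<m2} A2p"
    and d: "d \<in> rfun (nodesTO N T)"
  shows "d \<in> MOmega N T (marginal_set N m1 A1m A1p b1 m2 A2m A2p b2) \<longleftrightarrow>
    (\<forall>x\<in>N. \<forall>t\<in>{1..T}. d (x, At t) = 0) \<and>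
    (\<forall>k<m1. A1m (iota0_t N d) k - A1p (iotaO_t N d) k = b1 k) \<and>
    (\<forall>k<m2. b2 k \<le> A2m (iota0_t N d) k - A2p (iotaO_t N d) k)"
    (is "_ \<longleftrightarrow> ?mid \<and> ?eq \<and> ?le")
proof -
  let ?S = "marginal_set N m1 A1m A1p b1 m2 A2m A2p b2"
  let ?\<mu> = "iota0_t N d" and ?\<nu> = "\<lambda>x\<in>N. - iotaO_t N d x"
  have r: "inj_at_t N s d \<in> rfun N" for s
    by (simp add: inj_at_t_def)
  have S: "(?\<mu>, ?\<nu>) \<in> ?S \<longleftrightarrow> ?eq \<and> ?le"
    using r linear_rfun_minus[OF A(1) r] linear_rfun_minus[OF A(2) r]
    by (simp add: marginal_set_def)
  have "d \<in> MOmega N T ?S \<longleftrightarrow> ?mid \<and> (?\<mu>, ?\<nu>) \<in> ?S"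
  proof
    assume "d \<in> MOmega N T ?S"
    then obtain \<mu> \<nu> where mn: "(\<mu>, \<nu>) \<in> ?S"
      and d': "d = (\<lambda>p\<in>nodesTO N T. iota0 N T \<mu> p - iotaO N T \<nu> p)"
      by (auto simp: MOmega_def)
    have "\<mu> \<in> rfun N" "\<nu> \<in> rfun N"
      using mn by (auto simp: marginal_set_def)
    then have "?\<mu> = \<mu>" "?\<nu> = \<nu>"
      unfolding d'
      by (auto simp: fun_eq_iff inj_at_t_def inj_at_def nodesTO_def nodesT_def PiE_iff extensional_def)
    moreover have ?mid
      unfolding d' by (auto simp: inj_at_def nodesTO_def nodesT_def)
    ultimately show "?mid \<and> (?\<mu>, ?\<nu>) \<in> ?S"
      using mn by simp
  next
    assume *: "?mid \<and> (?\<mu>, ?\<nu>) \<in> ?S"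
    have "d p = (\<lambda>p\<in>nodesTO N T. iota0 N T ?\<mu> p - iotaO N T ?\<nu> p) p" for p
    proof (cases "p \<in> nodesTO N T")
      case True
      then obtain x s where p: "p = (x, s)" "x \<in> N" "s = Omega \<or> (\<exists>t\<le>T. s = At t)"
        by (auto simp: nodesTO_def nodesT_def)
      then consider "s = Omega" | "s = At 0" | t where "t \<in> {1..T}" "s = At t"
        by (metis One_nat_def Suc_leI atLeastAtMost_iff not_gr_zero)
      then show ?thesis
        using True p * by cases (auto simp: inj_at_def inj_at_t_def)
    next
      case False
      then show ?thesis using PiE_arb[OF d False] by simp
    qed
    then have "d = (\<lambda>p\<in>nodesTO N T. iota0 N T ?\<mu> p - iotaO N T ?\<nu> p)"
      by blast
    with * d show "d \<in> MOmega N T ?S"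
      unfolding MOmega_def by blast
  qed
  with S show ?thesis by blast
qed

subsection \<open>The optimality system\<close>

text \<open>The equalities passed to \<open>kkt_orthant\<close> are conservation at each node with
  time in \<open>{1..T}\<close> and the rows of \<open>A1m\<close>, \<open>A1p\<close>; the
  inequalities are the rows of \<open>A2m\<close>, \<open>A2p\<close>. The conservation multipliers
  enter \<open>u\<close> only in the middle layers, so its values at the two end layers come from
  the marginal multipliers alone, which is the required coupling.\<close>

lemma optimality_imp_system:
  fixes N :: "'a set" and E :: "('a \<times> 'a) set"
  assumes N: "finite N" and E: "E \<subseteq> N \<times> N"
    and A1: "linear_rfun N {..<m1} A1m" "linear_rfun N {..<m1} A1p"
    and A2: "linear_rfun N {..<m2} A2m" "linear_rfun N {..<m2} A2p"
    and g: "has_gradient (edgesTO N E T) (ext_cost E T H) i g"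
    and i: "i \<in> BP (graphTO N E T) (MOmega N T (marginal_set N m1 A1m A1p b1 m2 A2m A2p b2))
      (ext_cost E T H)"
  shows "\<exists>u \<in> rfun (nodesTO N T). \<exists>u1 \<in> rfun {..<m1}. \<exists>u2 \<in> rfun {..<m2}.
    optimality_system N E T m1 A1m A1p b1 m2 A2m A2p b2 H i u u1 u2"
proof -
  let ?V = "nodesTO N T" and ?X = "edgesTO N E T"
  let ?M = "MOmega N T (marginal_set N m1 A1m A1p b1 m2 A2m A2p b2)"
  define F2 where "F2 = marginal_coeff N A2m A2p"
  \<comment> \<open>\<open>Inl (x, t)\<close> gives the indicator of the node
    \<open>(x, At t)\<close>, whose pairing with the divergence is its value there.\<close>
  define F1 where "F1 = case_sum (\<lambda>q p. if p = (fst q, At (snd q)) then 1 else 0)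
    (marginal_coeff N A1m A1p)"
  define L where "L = (N \<times> {1..T}) <+> {..<m1}"
  define \<beta> where "\<beta> = case_sum (\<lambda>q :: 'a \<times> nat. 0) b1"
  have F1s: "F1 (Inl q) p = (if p = (fst q, At (snd q)) then 1 else 0)"
    "F1 (Inr k) = marginal_coeff N A1m A1p k" for q p k
    by (simp_all add: F1_def)
  have \<beta>s: "\<beta> (Inl q) = 0" "\<beta> (Inr k) = b1 k" for q k
    by (simp_all add: \<beta>_def)
  have V: "finite ?V" and X: "finite ?X" and EV: "?X \<subseteq> ?V \<times> ?V"
    using N E by (simp_all add: finite_nodesTO finite_edgesTO edgesTO_subset)
  let ?d = "divg ?V ?X"
  have feas: "?d j \<in> ?M \<longleftrightarrow> (\<forall>k\<in>{..<m2}. b2 k \<le> (\<Sum>e\<in>?X. - grad ?X (F2 k) e * j e)) \<and>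
      (\<forall>l\<in>L. (\<Sum>e\<in>?X. - grad ?X (F1 l) e * j e) = \<beta> l)" for j
  proof -
    have "(\<Sum>p\<in>?V. F1 (Inl (x, t)) p * ?d j p) = ?d j (x, At t)"
      if "x \<in> N" "t \<in> {1..T}" for x t
    proof -
      have "(x, At t) \<in> ?V"
        using that by (auto simp: nodesTO_def nodesT_def)
      then show ?thesis
        using V by (simp add: F1s if_distrib[where f = "\<lambda>y. y * _"] cong: if_cong)
    qed
    then have "(\<forall>l\<in>L. (\<Sum>p\<in>?V. F1 l p * ?d j p) = \<beta> l) \<longleftrightarrow>
        (\<forall>x\<in>N. \<forall>t\<in>{1..T}. ?d j (x, At t) = 0) \<and>
        (\<forall>k<m1. A1m (iota0_t N (?d j)) k - A1p (iotaO_t N (?d j)) k = b1 k)"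
      using sum_marginal_coeff[OF N _ A1, where T = T and d = "?d j"]
      by (auto simp: L_def \<beta>s F1s(2) Ball_def Plus_def)
    moreover have "(\<Sum>p\<in>?V. F2 k p * ?d j p) = A2m (iota0_t N (?d j)) k - A2p (iotaO_t N (?d j)) k"
      if "k < m2" for k
      using sum_marginal_coeff[OF N _ A2, where k = k and T = T and d = "?d j"] that by (simp add: F2_def)
    moreover have d: "?d j \<in> rfun ?V"
      by (simp add: divg_def)
    ultimately show ?thesis
      unfolding MOmega_marginal_set_iff[OF A1(2) A2(2) d] sum_divg[OF V EV, symmetric] by auto
  qed
  have iO: "i \<in> orthant ?X" and iM: "?d i \<in> ?M"
    and imin: "\<And>j. j \<in> orthant ?X \<Longrightarrow> ?d j \<in> ?M \<Longrightarrow> ext_cost E T H i \<le> ext_cost E T H j"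
    using i by (auto simp: BP_def graphTO_def is_arg_min_def not_less)
  obtain w v where w: "\<And>k. k \<in> {..<m2} \<Longrightarrow> min ((\<Sum>e\<in>?X. - grad ?X (F2 k) e * i e) - b2 k) (w k) = 0"
    and v: "\<And>e. e \<in> ?X \<Longrightarrow> min (i e) (g e - (\<Sum>k\<in>{..<m2}. w k * - grad ?X (F2 k) e)
      - (\<Sum>l\<in>L. v l * - grad ?X (F1 l) e)) = 0"
  proof (rule kkt_orthant[OF X _ _ iO g,
      where K = "{..<m2}" and L = L and \<alpha> = b2 and \<beta> = \<beta>
        and a = "\<lambda>k e. - grad ?X (F2 k) e" and b = "\<lambda>l e. - grad ?X (F1 l) e"])
    show "finite L" using N by (simp add: L_def)
    show "ext_cost E T H i \<le> ext_cost E T H j"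
      if "j \<in> orthant ?X" "\<And>k. k \<in> {..<m2} \<Longrightarrow> b2 k \<le> (\<Sum>e\<in>?X. - grad ?X (F2 k) e * j e)"
        "\<And>l. l \<in> L \<Longrightarrow> (\<Sum>e\<in>?X. - grad ?X (F1 l) e * j e) = \<beta> l" for j
      using that by (intro imin) (auto simp: feas)
  qed (use iM feas in auto)
  \<comment> \<open>The constraint functionals are \<open>- grad\<close> of the node functions, so
    the outer minus makes \<open>grad\<close> of \<open>u\<close> equal to their weighted
    sum.\<close>
  define u where "u = (\<lambda>p\<in>?V. - ((\<Sum>k\<in>{..<m2}. w k * F2 k p) + (\<Sum>l\<in>L. v l * F1 l p)))"
  \<comment> \<open>Equality multipliers have free sign, and this choice makes the transposes for
    \<open>u1\<close> enter with the sign opposite to those for \<open>u2\<close>, which has to stay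
    nonnegative.\<close>
  define u1 where "u1 = (\<lambda>k\<in>{..<m1}. - v (Inr k))"
  define u2 where "u2 = restrict w {..<m2}"
  have gu: "grad ?X u e = (\<Sum>k\<in>{..<m2}. w k * - grad ?X (F2 k) e) + (\<Sum>l\<in>L. v l * - grad ?X (F1 l) e)"
    if "e \<in> ?X" for e
    using that EV by (auto simp: grad_def u_def right_diff_distrib sum_subtractf)
  \<comment> \<open>The conservation indicators sit at times \<open>t \<ge> 1\<close> and so vanish
    at \<open>At 0\<close> and at \<open>Omega\<close>.\<close>
  have end_layer: "u (x, s) = - (\<Sum>k\<in>{..<m2}. w k * F2 k (x, s))
      + (\<Sum>k\<in>{..<m1}. u1 k * marginal_coeff N A1m A1p k (x, s))"
    if "x \<in> N" "s \<in> {At 0, Omega}" for x s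
  proof -
    have "(x, s) \<in> ?V"
      using that by (auto simp: nodesTO_def nodesT_def)
    moreover have "(\<Sum>q\<in>N \<times> {1..T}. v (Inl q) * F1 (Inl q) (x, s)) = 0"
      using that by (intro sum.neutral) (auto simp: F1s)
    ultimately show ?thesis
      using N by (simp add: u_def u1_def L_def sum.Plus F1s(2) sum_negf)
  qed
  have "optimality_system N E T m1 A1m A1p b1 m2 A2m A2p b2 H i u u1 u2"
    unfolding optimality_system_def Let_def gradient_eqI[OF X iO g]
  proof (intro conjI ballI allI impI)
    have "?d i \<in> rfun ?V"
      by (simp add: divg_def)
    note M = iM[unfolded MOmega_marginal_set_iff[OF A1(2) A2(2) this]]
    show "iota0_t N u x = transpose_rfun N {..<m1} A1m u1 x - transpose_rfun N {..<m2} A2m u2 x"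
      if "x \<in> N" for x
      using that by (simp add: inj_at_t_def end_layer transpose_rfun_def F2_def marginal_coeff_def u2_def mult.commute)
    show "iotaO_t N u x = - (transpose_rfun N {..<m1} A1p u1 x - transpose_rfun N {..<m2} A2p u2 x)"
      if "x \<in> N" for x
      using that by (simp add: inj_at_t_def end_layer transpose_rfun_def F2_def marginal_coeff_def u2_def mult.commute sum_negf)
    show "min (i e) (g e - grad ?X u e) = 0" if "e \<in> ?X" for e
      using v[OF that] gu[OF that] by (simp add: algebra_simps)
    show "?d i (x, At t) = 0" if "x \<in> N" "t \<in> {1..T}" for x t
      using M that by blast
    show "A1m (iota0_t N (?d i)) k - A1p (iotaO_t N (?d i)) k = b1 k" if "k < m1" for k
      using M that by blast
    show "min (A2m (iota0_t N (?d i)) k - A2p (iotaO_t N (?d i)) k - b2 k) (u2 k) = 0" if "k < m2" for k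
      using w[of k] that sum_marginal_coeff[OF N _ A2, where k = k and T = T and d = "?d i"]
      by (simp only: sum_divg[OF V EV, symmetric]) (simp add: F2_def u2_def)
  qed
  moreover have "u \<in> rfun ?V" "u1 \<in> rfun {..<m1}" "u2 \<in> rfun {..<m2}"
    by (simp_all add: u_def u1_def u2_def)
  ultimately show ?thesis by blast
qed

section \<open>Sufficiency for convex cost\<close>

text \<open>Gradients are supplied at all points of the orthant because the nonnegativity of
  \<open>i\<close> is itself deduced from the system.\<close>

lemma system_imp_optimality:
  fixes N :: "'a set" and E :: "('a \<times> 'a) set"
  assumes N: "finite N" and E: "E \<subseteq> N \<times> N"
    and A1: "linear_rfun N {..<m1} A1m" "linear_rfun N {..<m1} A1p"
    and A2: "linear_rfun N {..<m2} A2m" "linear_rfun N {..<m2} A2p"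
    and g: "\<And>i. i \<in> orthant (edgesTO N E T) \<Longrightarrow> has_gradient (edgesTO N E T) (ext_cost E T H) i (g i)"
    and H: "convex_orthant (edgesTO N E T) (ext_cost E T H)"
    and i: "i \<in> rfun (edgesTO N E T)"
    and sys: "optimality_system N E T m1 A1m A1p b1 m2 A2m A2p b2 H i u u1 u2"
  shows "i \<in> BP (graphTO N E T) (MOmega N T (marginal_set N m1 A1m A1p b1 m2 A2m A2p b2))
    (ext_cost E T H)"
proof -
  let ?V = "nodesTO N T" and ?X = "edgesTO N E T"
  let ?M = "MOmega N T (marginal_set N m1 A1m A1p b1 m2 A2m A2p b2)"
  let ?d = "divg ?V ?X"
  let ?B1 = "\<lambda>d k. A1m (iota0_t N d) k - A1p (iotaO_t N d) k"
  let ?B2 = "\<lambda>d k. A2m (iota0_t N d) k - A2p (iotaO_t N d) k"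
  have V: "finite ?V" and X: "finite ?X" and EV: "?X \<subseteq> ?V \<times> ?V"
    using N E by (simp_all add: finite_nodesTO finite_edgesTO edgesTO_subset)
  have dr: "?d j \<in> rfun ?V" for j
    by (simp add: divg_def)
  note sys' = sys[unfolded optimality_system_def Let_def]
  have e: "min (i e) (gradient ?X (ext_cost E T H) i e - grad ?X u e) = 0" if "e \<in> ?X" for e
    using sys' that by blast
  have iO: "i \<in> orthant ?X"
    using i e by (force simp: PiE_iff min_def split: if_splits)
  have k2: "min (?B2 (?d i) k - b2 k) (u2 k) = 0" if "k < m2" for k
    using sys' that by blast
  have iM: "?d i \<in> ?M"
    unfolding MOmega_marginal_set_iff[OF A1(2) A2(2) dr]
    using sys' k2 by (force simp: min_def split: if_splits)
  \<comment> \<open>For feasible \<open>j\<close> the middle layers drop out, and the adjoints move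
    \<open>u1\<close> and \<open>u2\<close> onto the constraint rows. The equality rows give a
    constant, so two feasible flows differ only in the inequality rows.\<close>
  have pair: "(\<Sum>p\<in>?V. u p * ?d j p) = (\<Sum>k<m1. b1 k * u1 k) - (\<Sum>k<m2. ?B2 (?d j) k * u2 k)"
    if j: "?d j \<in> ?M" for j
  proof -
    note M = j[unfolded MOmega_marginal_set_iff[OF A1(2) A2(2) dr]]
    let ?f = "\<lambda>s. inj_at_t N s (?d j)"
    have r: "?f s \<in> rfun N" for s
      by (simp add: inj_at_t_def)
    have "(\<Sum>p\<in>?V. u p * ?d j p)
        = (\<Sum>x\<in>N. ?f (At 0) x * iota0_t N u x) + (\<Sum>x\<in>N. ?f Omega x * iotaO_t N u x)"
      unfolding sum_nodesTO[OF N] using M by (simp add: inj_at_t_def mult.commute)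
    also have "(\<Sum>x\<in>N. ?f (At 0) x * iota0_t N u x)
        = (\<Sum>k<m1. A1m (?f (At 0)) k * u1 k) - (\<Sum>k<m2. A2m (?f (At 0)) k * u2 k)"
      unfolding transpose_rfun_adjoint[OF A1(1) N r] transpose_rfun_adjoint[OF A2(1) N r]
      using sys' by (simp add: right_diff_distrib sum_subtractf)
    also have "(\<Sum>x\<in>N. ?f Omega x * iotaO_t N u x)
        = (\<Sum>k<m2. A2p (?f Omega) k * u2 k) - (\<Sum>k<m1. A1p (?f Omega) k * u1 k)"
      unfolding transpose_rfun_adjoint[OF A1(2) N r] transpose_rfun_adjoint[OF A2(2) N r]
      using sys' by (simp add: right_diff_distrib sum_subtractf)
    also have "(\<Sum>k<m1. A1m (?f (At 0)) k * u1 k) - (\<Sum>k<m2. A2m (?f (At 0)) k * u2 k)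
        + ((\<Sum>k<m2. A2p (?f Omega) k * u2 k) - (\<Sum>k<m1. A1p (?f Omega) k * u1 k))
        = (\<Sum>k<m1. ?B1 (?d j) k * u1 k) - (\<Sum>k<m2. ?B2 (?d j) k * u2 k)"
      by (simp add: left_diff_distrib sum_subtractf)
    also have "(\<Sum>k<m1. ?B1 (?d j) k * u1 k) = (\<Sum>k<m1. b1 k * u1 k)"
      using M by (intro sum.cong) auto
    finally show ?thesis .
  qed
  have "ext_cost E T H i \<le> ext_cost E T H j" if jO: "j \<in> orthant ?X" and jM: "?d j \<in> ?M" for j
  proof -
    note M = jM[unfolded MOmega_marginal_set_iff[OF A1(2) A2(2) dr]]
    \<comment> \<open>Either \<open>u2 k = 0\<close>, or row \<open>k\<close> is active at
      \<open>i\<close> and the difference is the nonnegative slack of \<open>j\<close>.\<close>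
    have "0 \<le> (\<Sum>k<m2. (?B2 (?d j) k - ?B2 (?d i) k) * u2 k)"
    proof (rule sum_nonneg)
      fix k assume k: "k \<in> {..<m2}"
      then have "b2 k \<le> ?B2 (?d j) k" using M by blast
      with k2[of k] k show "0 \<le> (?B2 (?d j) k - ?B2 (?d i) k) * u2 k"
        by (auto simp: min_def split: if_splits)
    qed
    also have "\<dots> = (\<Sum>p\<in>?V. u p * ?d i p) - (\<Sum>p\<in>?V. u p * ?d j p)"
      unfolding pair[OF iM] pair[OF jM]
      by (simp add: left_diff_distrib sum_subtractf)
    also have "\<dots> = (\<Sum>e\<in>?X. grad ?X u e * (j e - i e))"
      unfolding sum_divg[OF V EV] by (simp add: right_diff_distrib sum_subtractf sum_negf)
    also have "\<dots> \<le> (\<Sum>e\<in>?X. g i e * (j e - i e))"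
    proof (rule sum_mono)
      fix e' assume e': "e' \<in> ?X"
      then have "0 \<le> j e'" using jO by (auto simp: PiE_iff)
      \<comment> \<open>Either the first factor is zero, or \<open>i e' = 0\<close> and both factors
        are nonnegative.\<close>
      then have "0 \<le> (g i e' - grad ?X u e') * (j e' - i e')"
        using e[OF e'] unfolding gradient_eqI[OF X iO g[OF iO]]
        by (auto simp: min_def split: if_splits)
      then show "grad ?X u e' * (j e' - i e') \<le> g i e' * (j e' - i e')"
        by (simp add: left_diff_distrib)
    qed
    also have "\<dots> \<le> ext_cost E T H j - ext_cost E T H i"
      by (rule convex_orthant_gradient_le[OF X H iO jO g[OF iO]])
    finally show ?thesis by simp
  qed
  then show ?thesis
    using iO iM by (auto simp: BP_def graphTO_def is_arg_min_def not_less)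
qed

theorem theorem4p8:
  fixes N :: "'a set" and E :: "('a \<times> 'a) set" and T m1 m2 :: nat
    and A1m A1p A2m A2p :: "('a \<Rightarrow> real) \<Rightarrow> (nat \<Rightarrow> real)" and b1 b2 :: "nat \<Rightarrow> real"
    and S :: "(('a \<Rightarrow> real) \<times> ('a \<Rightarrow> real)) set"
    and H :: "('a edge \<Rightarrow> real) \<Rightarrow> real"
  assumes "finite N" and "E \<subseteq> N \<times> N" and "T \<ge> 1"
    and "linear_rfun N {..<m1} A1m" and "linear_rfun N {..<m1} A1p"
    and "linear_rfun N {..<m2} A2m" and "linear_rfun N {..<m2} A2p"
    and "b1 \<in> rfun {..<m1}" and "b2 \<in> rfun {..<m2}"
    and "S = marginal_set N m1 A1m A1p b1 m2 A2m A2p b2"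
    and "S \<subseteq> prob_on N \<times> prob_on N"
    and "C1_orthant (edgesT E T) H"
  shows "(\<forall>i \<in> BP (graphTO N E T) (MOmega N T S) (ext_cost E T H).
           \<exists>u \<in> rfun (nodesTO N T). \<exists>u1 \<in> rfun {..<m1}. \<exists>u2 \<in> rfun {..<m2}.
             optimality_system N E T m1 A1m A1p b1 m2 A2m A2p b2 H i u u1 u2) \<and>
         (convex_orthant (edgesT E T) H \<longrightarrow>
           (\<forall>i \<in> rfun (edgesTO N E T). \<forall>u \<in> rfun (nodesTO N T).
            \<forall>u1 \<in> rfun {..<m1}. \<forall>u2 \<in> rfun {..<m2}.
              optimality_system N E T m1 A1m A1p b1 m2 A2m A2p b2 H i u u1 u2 \<longrightarrow>
              i \<in> BP (graphTO N E T) (MOmega N T S) (ext_cost E T H)))"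
proof -
  let ?X = "edgesT E T" and ?Y = "edgesTO N E T"
  have ext: "ext_cost E T H = (\<lambda>j. H (restrict j ?X))"
    by (simp add: ext_cost_def fun_eq_iff)
  have XY: "?X \<subseteq> ?Y"
    by (simp add: edgesTO_def)
  have Y: "finite ?Y"
    using assms by (simp add: finite_edgesTO)
  obtain g where g: "\<And>i. i \<in> orthant ?X \<Longrightarrow> has_gradient ?X H i (g i)"
    using assms(12) unfolding C1_orthant_def by blast
  \<comment> \<open>The extended cost ignores the edges into \<open>Omega\<close>, so its gradient
    is \<open>g\<close> padded with zeros there.\<close>
  define G where "G i = (\<lambda>e\<in>?Y. if e \<in> ?X then g (restrict i ?X) e else 0)" for i
  have G: "has_gradient ?Y (ext_cost E T H) i (G i)" if i: "i \<in> orthant ?Y" for i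
  proof -
    have "restrict i ?X \<in> orthant ?X"
      using i XY by (auto simp: PiE_iff)
    then show ?thesis
      unfolding ext G_def by (intro has_gradient_restrict[OF Y XY i] g)
  qed
  show ?thesis
  proof (intro conjI ballI impI)
    fix i assume i: "i \<in> BP (graphTO N E T) (MOmega N T S) (ext_cost E T H)"
    then have "i \<in> orthant ?Y"
      by (simp add: BP_def graphTO_def is_arg_min_def)
    from optimality_imp_system[OF assms(1,2,4-7) G[OF this] i[unfolded assms(10)]]
    show "\<exists>u \<in> rfun (nodesTO N T). \<exists>u1 \<in> rfun {..<m1}. \<exists>u2 \<in> rfun {..<m2}.
      optimality_system N E T m1 A1m A1p b1 m2 A2m A2p b2 H i u u1 u2" .
  next
    fix i u u1 u2
    assume "convex_orthant ?X H" and i: "i \<in> rfun ?Y"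
      and sys: "optimality_system N E T m1 A1m A1p b1 m2 A2m A2p b2 H i u u1 u2"
    then have "convex_orthant ?Y (ext_cost E T H)"
      unfolding ext using XY by (intro convex_orthant_restrict)
    from system_imp_optimality[OF assms(1,2,4-7) G this i sys]
    show "i \<in> BP (graphTO N E T) (MOmega N T S) (ext_cost E T H)"
      unfolding assms(10) .
  qed
qed

end
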